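(* Let $\alpha=(\alpha_n)_{n\in\mathbb{N}}$ be a non-negative increasing sequence with $\lim_{n\to\infty}\alpha_n=\infty$, and assume that $\alpha$ is stable. For every $\theta\in\Lambda_\infty(\alpha)$, the convolution operator $\widehat{T}_\theta:\Lambda_\infty(\alpha)\to\Lambda_\infty(\alpha)$ is topologizable. Moreover, for $\theta\in\Lambda_\infty(\alpha)$, the operator $\widehat{T}_\theta:\Lambda_\infty(\alpha)\to\Lambda_\infty(\alpha)$ is m-topologizable if and only if for every $p\in\mathbb{N}$ there exists $D_p>0$ such that $\|\theta^{*k}\|_p\le D_p^k$ for every $k\in\mathbb{N}$.
   Context: $\mathbb{N}=\{1,2,\dots\}$, $\mathbb{N}_0=\mathbb{N}\cup\{0\}$. The sequence $\alpha$ is stable if $\sup_{n\in\mathbb{N}}\alpha_{2n}/\alpha_n<\infty$. The power series space of infinite type is $\Lambda_\infty(\alpha)=\{x=(x_n)_{n\in\mathbb{N}}:\|x\|_k:=\sum_{n=1}^\infty|x_n|e^{k\alpha_n}<\infty\text{ for all }k\in\mathbb{N}\}$, a Fréchet space with the increasing sequence of seminorms $(\|\cdot\|_k)_{k\in\mathbb{N}}$; $(e_n)_{n\in\mathbb{N}}$ is its canonical basis. Symbols are indexed from $0$: $\theta=(\theta_n)_{n\in\mathbb{N}_0}$ is regarded as the element of $\Lambda_\infty(\alpha)$ whose $n$-th coordinate ($n\in\mathbb{N}$) is $\theta_{n-1}$, so $\|\theta\|_k=\sum_{n=1}^\infty|\theta_{n-1}|e^{k\alpha_n}$. The convolution operator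 $\widehat{T}_\theta$ is the continuous linear operator on $\Lambda_\infty(\alpha)$ with $\widehat{T}_\theta e_n=\sum_{j=n}^\infty\theta_{j-n}e_j$ and $\widehat{T}_\theta x=\sum_{n=1}^\infty x_n\widehat{T}_\theta e_n$ (it is well-defined and continuous for every $\theta\in\Lambda_\infty(\alpha)$ when $\alpha$ is stable). Convolution of sequences indexed by $\mathbb{N}_0$: $(\theta*\phi)_m=\sum_{i=0}^m\theta_i\phi_{m-i}$; $\theta^{*k}=\theta*\cdots*\theta$ ($k$ factors). A continuous linear operator $T$ on a Fréchet space $E$ with increasing seminorms $(\|\cdot\|_p)_{p\in\mathbb{N}}$ is topologizable if for every $p\in\mathbb{N}$ there is $q\in\mathbb{N}$ such that for every $k\in\mathbb{N}$ there is $M_{k,p}>0$ with $\|T^kx\|_p\le M_{k,p}\|x\|_q$ for all $x\in E$. It is m-topologizable if for every $p\in\mathbb{N}$ there exist $q\in\mathbb{N}$ and $C_p\ge1$ with $\|T^kx\|_p\le C_p^k\|x\|_q$ for all $k\in\mathbb{N}$, $x\in E$. *)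

theory Defs
  imports "HOL-Analysis.Analysis"
begin

text \<open>
  The scalar field is a type of class \<open>real_normed_field\<close> and \<open>banach\<close>; up to isometric
  isomorphism these are exactly the real and the complex numbers.

  The exponent sequence \<open>\<alpha>\<close> is indexed from 1 (the value \<open>\<alpha> 0\<close> is never used). A scalar sequence
  is stored from index 0: its coordinate number \<open>n \<ge> 1\<close> is \<open>x (n - 1)\<close>. Hence a symbol
  \<open>\<theta>\<close> indexed from 0 is, as a function, the same thing as the element of the power series space
  it is identified with, and coordinate \<open>x n\<close> carries the weight of \<open>\<alpha> (Suc n)\<close>.
\<close>

text \<open>
  The quotient is the real quotient with \<open>c / 0 = 0\<close>, so indices with \<open>\<alpha> n = 0\<close> impose no
  condition. This makes \<open>\<alpha> n = ln n\<close> stable although \<open>\<alpha> 1 = 0\<close>.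
\<close>
definition stable_seq :: "(nat \<Rightarrow> real) \<Rightarrow> bool" where
  "stable_seq \<alpha> \<longleftrightarrow> bdd_above ((\<lambda>n. \<alpha> (2 * n) / \<alpha> n) ` {1..})"

definition pss_norm :: "(nat \<Rightarrow> real) \<Rightarrow> nat \<Rightarrow> (nat \<Rightarrow> 'a::{real_normed_field,banach}) \<Rightarrow> real" where
  "pss_norm \<alpha> k x = (\<Sum>n. norm (x n) * exp (real k * \<alpha> (Suc n)))"

definition power_series_space :: "(nat \<Rightarrow> real) \<Rightarrow> (nat \<Rightarrow> 'a::{real_normed_field,banach}) set" where
  "power_series_space \<alpha> = {x. \<forall>k\<ge>1. summable (\<lambda>n. norm (x n) * exp (real k * \<alpha> (Suc n)))}"

text \<open>
  Below, \<open>E\<close> is a space of scalar sequences with pointwise operations and \<open>P 1, P 2, \<dots>\<close> are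
  its seminorms (\<open>P 0\<close> is never used).
\<close>

definition seminorm_topology ::
  "(nat \<Rightarrow> 'a::{real_normed_field,banach}) set \<Rightarrow> (nat \<Rightarrow> (nat \<Rightarrow> 'a) \<Rightarrow> real) \<Rightarrow> (nat \<Rightarrow> 'a) topology" where
  "seminorm_topology E P = topology_generated_by
     {{y \<in> E. P k (\<lambda>n. y n - x n) < r} | x k r. x \<in> E \<and> 1 \<le> k \<and> 0 < r}"

definition continuous_linear_operator ::
  "(nat \<Rightarrow> 'a::{real_normed_field,banach}) set \<Rightarrow> (nat \<Rightarrow> (nat \<Rightarrow> 'a) \<Rightarrow> real) \<Rightarrow>
   ((nat \<Rightarrow> 'a) \<Rightarrow> (nat \<Rightarrow> 'a)) \<Rightarrow> bool" where
  "continuous_linear_operator E P T \<longleftrightarrow>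
     (\<forall>x\<in>E. T x \<in> E) \<and>
     (\<forall>x\<in>E. \<forall>y\<in>E. T (\<lambda>n. x n + y n) = (\<lambda>n. T x n + T y n)) \<and>
     (\<forall>c. \<forall>x\<in>E. T (\<lambda>n. c * x n) = (\<lambda>n. c * T x n)) \<and>
     continuous_map (seminorm_topology E P) (seminorm_topology E P) T"

definition topologizable ::
  "(nat \<Rightarrow> 'a::{real_normed_field,banach}) set \<Rightarrow> (nat \<Rightarrow> (nat \<Rightarrow> 'a) \<Rightarrow> real) \<Rightarrow>
   ((nat \<Rightarrow> 'a) \<Rightarrow> (nat \<Rightarrow> 'a)) \<Rightarrow> bool" where
  "topologizable E P T \<longleftrightarrow> continuous_linear_operator E P T \<and>
     (\<forall>p\<ge>1. \<exists>q\<ge>1. \<forall>k\<ge>1. \<exists>M>0. \<forall>x\<in>E. P p ((T ^^ k) x) \<le> M * P q x)"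

definition m_topologizable ::
  "(nat \<Rightarrow> 'a::{real_normed_field,banach}) set \<Rightarrow> (nat \<Rightarrow> (nat \<Rightarrow> 'a) \<Rightarrow> real) \<Rightarrow>
   ((nat \<Rightarrow> 'a) \<Rightarrow> (nat \<Rightarrow> 'a)) \<Rightarrow> bool" where
  "m_topologizable E P T \<longleftrightarrow> continuous_linear_operator E P T \<and>
     (\<forall>p\<ge>1. \<exists>q\<ge>1. \<exists>C\<ge>1. \<forall>k\<ge>1. \<forall>x\<in>E. P p ((T ^^ k) x) \<le> C ^ k * P q x)"

text \<open>
  The sum of the series \<open>f a + f (a + 1) + \<dots>\<close> in \<open>E\<close>, unspecified if it does not converge there.
\<close>
definition series_from ::
  "(nat \<Rightarrow> 'a::{real_normed_field,banach}) set \<Rightarrow> (nat \<Rightarrow> (nat \<Rightarrow> 'a) \<Rightarrow> real) \<Rightarrow>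
   nat \<Rightarrow> (nat \<Rightarrow> nat \<Rightarrow> 'a) \<Rightarrow> (nat \<Rightarrow> 'a)" where
  "series_from E P a f =
     (THE y. limitin (seminorm_topology E P) (\<lambda>N m. \<Sum>j=a..<N. f j m) y sequentially)"

text \<open>With the storage convention above, \<open>basis_seq n\<close> is the canonical basis vector number \<open>n + 1\<close>.\<close>
definition basis_seq :: "nat \<Rightarrow> nat \<Rightarrow> 'a::{real_normed_field,banach}" where
  "basis_seq n = (\<lambda>m. if m = n then 1 else 0)"

text \<open>
  Both series are taken in the topology of the power series space. The formula for the image of
  a basis vector depends only on \<open>j - n\<close> and so is unaffected by the index shift.
\<close>
definition conv_op_basis ::
  "(nat \<Rightarrow> real) \<Rightarrow> (nat \<Rightarrow> 'a::{real_normed_field,banach}) \<Rightarrow> nat \<Rightarrow> (nat \<Rightarrow> 'a)" where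
  "conv_op_basis \<alpha> \<theta> n =
     series_from (power_series_space \<alpha>) (pss_norm \<alpha>) n (\<lambda>j m. \<theta> (j - n) * basis_seq j m)"

definition conv_op ::
  "(nat \<Rightarrow> real) \<Rightarrow> (nat \<Rightarrow> 'a::{real_normed_field,banach}) \<Rightarrow> (nat \<Rightarrow> 'a) \<Rightarrow> (nat \<Rightarrow> 'a)" where
  "conv_op \<alpha> \<theta> x =
     series_from (power_series_space \<alpha>) (pss_norm \<alpha>) 0 (\<lambda>n m. x n * conv_op_basis \<alpha> \<theta> n m)"

definition seq_conv ::
  "(nat \<Rightarrow> 'a::{real_normed_field,banach}) \<Rightarrow> (nat \<Rightarrow> 'a) \<Rightarrow> (nat \<Rightarrow> 'a)" where
  "seq_conv \<theta> \<phi> = (\<lambda>m. \<Sum>i=0..m. \<theta> i * \<phi> (m - i))"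

text \<open>The empty convolution product is the unit \<open>basis_seq 0\<close> of \<open>seq_conv\<close>.\<close>
primrec conv_power ::
  "(nat \<Rightarrow> 'a::{real_normed_field,banach}) \<Rightarrow> nat \<Rightarrow> (nat \<Rightarrow> 'a)" where
  "conv_power \<theta> 0 = basis_seq 0"
| "conv_power \<theta> (Suc k) = seq_conv \<theta> (conv_power \<theta> k)"

end

theory Submission
  imports Defs
begin

text \<open>
  Stability says that doubling the index multiplies the exponents by at most a constant, up to an
  additive error: \<open>\<alpha> (2 n) \<le> L \<alpha> n + B\<close> with a natural number \<open>L \<ge> 1\<close>. Index \<open>i + j\<close> is at most
  twice the larger of \<open>i\<close> and \<open>j\<close>, so the weight at \<open>i + j\<close> is controlled by the product of the
  weights at \<open>i\<close> and at \<open>j\<close>, for a seminorm index enlarged by the factor \<open>L\<close>. The Cauchy product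
  of absolutely convergent series then yields (\<open>pss_norm_seq_conv_le\<close>)

  \<open>\<parallel>x * y\<parallel>\<^sub>p \<le> e\<^sup>p\<^sup>B \<parallel>x\<parallel>\<^sub>L\<^sub>p \<parallel>y\<parallel>\<^sub>L\<^sub>p\<close>.

  Hence the space is a convolution algebra, and both series that define the operator converge in
  it, with \<open>x \<mapsto> \<theta> * x\<close> as the result (\<open>conv_op_eq_seq_conv\<close>). By associativity the \<open>k\<close>-th iterate
  is convolution with \<open>\<theta>\<^sup>*\<^sup>k\<close>, and the inequality, applied to \<open>\<theta>\<^sup>*\<^sup>k\<close> and \<open>x\<close>, bounds
  it in the seminorm \<open>p\<close> by a multiple of the seminorm \<open>q = L p\<close>. This \<open>q\<close> is independent of \<open>k\<close>,
  which is topologizability; the factor \<open>e\<^sup>p\<^sup>B \<parallel>\<theta>\<^sup>*\<^sup>k\<parallel>\<^sub>L\<^sub>p\<close> grows at most geometrically in \<open>k\<close> if the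
  norms of the convolution powers do. Conversely, the \<open>k\<close>-th iterate maps the first
  basis vector, the unit of convolution, to \<open>\<theta>\<^sup>*\<^sup>k\<close>, so bounds on the iterates bound the powers.
\<close>

section \<open>Convolution of sequences as multiplication of formal power series\<close>

lemma seq_conv_eq_fps_mult: "seq_conv x y = fps_nth (Abs_fps x * Abs_fps y)"
  by (rule ext) (simp add: seq_conv_def fps_mult_nth)

lemma seq_conv_commute: "seq_conv x y = seq_conv y x"
  by (simp add: seq_conv_eq_fps_mult mult.commute)

lemma seq_conv_assoc: "seq_conv (seq_conv x y) z = seq_conv x (seq_conv y z)"
  by (simp add: seq_conv_eq_fps_mult fps_nth_inverse mult.assoc)

lemma seq_conv_basis_seq:
  fixes x :: "nat \<Rightarrow> 'a::{real_normed_field,banach}"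
  shows "seq_conv x (basis_seq n) m = (if n \<le> m then x (m - n) else 0)"
proof -
  have "Abs_fps (basis_seq n :: nat \<Rightarrow> 'a) = fps_X ^ n"
    by (rule fps_ext) (simp add: basis_seq_def)
  then show ?thesis
    by (simp add: seq_conv_eq_fps_mult fps_X_power_mult_right_nth)
qed

lemma seq_conv_basis_seq_0 [simp]: "seq_conv x (basis_seq 0) = x" "seq_conv (basis_seq 0) x = x"
  by (auto simp: seq_conv_basis_seq seq_conv_commute[of "basis_seq 0"])

lemma seq_conv_add_right: "seq_conv x (\<lambda>n. y n + z n) = (\<lambda>n. seq_conv x y n + seq_conv x z n)"
  by (simp add: seq_conv_def algebra_simps sum.distrib)

lemma seq_conv_diff_right: "seq_conv x (\<lambda>n. y n - z n) = (\<lambda>n. seq_conv x y n - seq_conv x z n)"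
  by (simp add: seq_conv_def algebra_simps sum_subtractf)

lemma seq_conv_scale_right: "seq_conv x (\<lambda>n. c * y n) = (\<lambda>n. c * seq_conv x y n)"
  by (simp add: seq_conv_def sum_distrib_left algebra_simps)

definition truncate_seq :: "nat \<Rightarrow> (nat \<Rightarrow> 'a::zero) \<Rightarrow> nat \<Rightarrow> 'a" where
  "truncate_seq N x = (\<lambda>m. if m < N then x m else 0)"

lemma sum_seq_conv_basis_seq:
  "(\<Sum>n<N. x n * seq_conv y (basis_seq n) m) = seq_conv y (truncate_seq N x) m"
proof -
  have "(\<Sum>n<N. x n * seq_conv y (basis_seq n) m) = (\<Sum>n<N. if n \<in> {0..m} then x n * y (m - n) else 0)"
    by (intro sum.cong) (auto simp: seq_conv_basis_seq)
  also have "\<dots> = (\<Sum>n\<in>{0..m} \<inter> {..<N}. x n * y (m - n))"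
    by (subst Int_commute) (simp only: sum.inter_restrict finite_lessThan)
  also have "\<dots> = (\<Sum>n=0..m. if n \<in> {..<N} then x n * y (m - n) else 0)"
    by (simp only: sum.inter_restrict finite_atLeastAtMost)
  also have "\<dots> = seq_conv (truncate_seq N x) y m"
    by (auto simp: seq_conv_def truncate_seq_def intro!: sum.cong)
  finally show ?thesis
    by (simp only: seq_conv_commute)
qed

section \<open>Seminorms and topology of a power series space\<close>

lemma power_series_space_summable:
  "x \<in> power_series_space \<alpha> \<Longrightarrow> k \<ge> 1 \<Longrightarrow> summable (\<lambda>n. norm (x n) * exp (real k * \<alpha> (Suc n)))"
  by (simp add: power_series_space_def)

lemma pss_norm_nonneg:
  assumes "x \<in> power_series_space \<alpha>" "k \<ge> 1"
  shows "0 \<le> pss_norm \<alpha> k x"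
  unfolding pss_norm_def by (rule suminf_nonneg[OF power_series_space_summable[OF assms]]) simp

lemma pss_norm_minus_commute:
  "pss_norm \<alpha> k (\<lambda>n. x n - y n) = pss_norm \<alpha> k (\<lambda>n. y n - x n)"
  by (simp add: pss_norm_def norm_minus_commute)

lemma power_series_space_add_pss_norm:
  assumes "x \<in> power_series_space \<alpha>" "y \<in> power_series_space \<alpha>"
  shows power_series_space_add: "(\<lambda>n. x n + y n) \<in> power_series_space \<alpha>"
    and pss_norm_triangle: "k \<ge> 1 \<Longrightarrow> pss_norm \<alpha> k (\<lambda>n. x n + y n) \<le> pss_norm \<alpha> k x + pss_norm \<alpha> k y"
proof -
  have le: "norm (x n + y n) * exp (real k * \<alpha> (Suc n)) \<le>
      norm (x n) * exp (real k * \<alpha> (Suc n)) + norm (y n) * exp (real k * \<alpha> (Suc n))" for n k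
    by (metis distrib_right exp_ge_zero mult_right_mono norm_triangle_ineq)
  have sum: "summable (\<lambda>n. norm (x n) * exp (real k * \<alpha> (Suc n)) + norm (y n) * exp (real k * \<alpha> (Suc n)))"
    if "k \<ge> 1" for k
    using that assms by (intro summable_add power_series_space_summable)
  have sum': "summable (\<lambda>n. norm (x n + y n) * exp (real k * \<alpha> (Suc n)))" if "k \<ge> 1" for k
    using le by (intro summable_comparison_test'[OF sum[OF that]]) simp
  then show "(\<lambda>n. x n + y n) \<in> power_series_space \<alpha>"
    by (simp add: power_series_space_def)
  show "pss_norm \<alpha> k (\<lambda>n. x n + y n) \<le> pss_norm \<alpha> k x + pss_norm \<alpha> k y" if k: "k \<ge> 1"
    unfolding pss_norm_def
    by (subst suminf_add)
       (use k assms le in \<open>auto intro!: suminf_le sum sum' power_series_space_summable\<close>)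
qed

lemma power_series_space_scale:
  "x \<in> power_series_space \<alpha> \<Longrightarrow> (\<lambda>n. c * x n) \<in> power_series_space \<alpha>"
  by (simp add: power_series_space_def norm_mult mult.assoc summable_mult)

lemma power_series_space_diff:
  assumes "x \<in> power_series_space \<alpha>" "y \<in> power_series_space \<alpha>"
  shows "(\<lambda>n. x n - y n) \<in> power_series_space \<alpha>"
  using power_series_space_add[OF assms(1) power_series_space_scale[OF assms(2), of "-1"]] by simp

lemma pss_norm_triangle_diff:
  assumes "x \<in> power_series_space \<alpha>" "y \<in> power_series_space \<alpha>" "z \<in> power_series_space \<alpha>" "k \<ge> 1"
  shows "pss_norm \<alpha> k (\<lambda>n. x n - z n) \<le> pss_norm \<alpha> k (\<lambda>n. x n - y n) + pss_norm \<alpha> k (\<lambda>n. y n - z n)"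
  using pss_norm_triangle[OF power_series_space_diff[OF assms(1,2)] power_series_space_diff[OF assms(2,3)] assms(4)]
  by simp

lemma pss_norm_eq_0_imp:
  assumes "x \<in> power_series_space \<alpha>" "k \<ge> 1" "pss_norm \<alpha> k x = 0"
  shows "x = (\<lambda>n. 0)"
  using suminf_eq_zero_iff[OF power_series_space_summable[OF assms(1,2)]] assms(3)
  by (auto simp: pss_norm_def)

lemma norm_basis_seq_sums:
  "(\<lambda>m. norm (basis_seq n m :: 'a::{real_normed_field,banach}) * exp (real k * \<alpha> (Suc m)))
     sums exp (real k * \<alpha> (Suc n))"
proof -
  have "(\<lambda>m. norm (basis_seq n m :: 'a) * exp (real k * \<alpha> (Suc m))) =
      (\<lambda>m. if m = n then exp (real k * \<alpha> (Suc m)) else 0)"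
    by (auto simp: basis_seq_def)
  then show ?thesis
    using sums_single[of n "\<lambda>m. exp (real k * \<alpha> (Suc m))"] by (simp only:)
qed

lemma basis_seq_in_power_series_space: "basis_seq n \<in> power_series_space \<alpha>"
  using norm_basis_seq_sums by (auto simp: power_series_space_def sums_iff)

lemma pss_norm_basis_seq:
  "pss_norm \<alpha> k (basis_seq n :: nat \<Rightarrow> 'a::{real_normed_field,banach}) = exp (real k * \<alpha> (Suc n))"
  unfolding pss_norm_def by (rule sums_unique[OF norm_basis_seq_sums, symmetric])

lemma truncate_seq_in_power_series_space:
  assumes "x \<in> power_series_space \<alpha>"
  shows "truncate_seq N x \<in> power_series_space \<alpha>"
proof -
  have "summable (\<lambda>n. norm (truncate_seq N x n) * exp (real k * \<alpha> (Suc n)))" if "k \<ge> 1" for k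
    by (rule summable_comparison_test'[OF power_series_space_summable[OF assms that]])
       (simp add: truncate_seq_def)
  then show ?thesis
    by (simp add: power_series_space_def)
qed

lemma pss_norm_truncate_seq_tendsto:
  assumes x: "x \<in> power_series_space \<alpha>" and k: "k \<ge> 1"
  shows "(\<lambda>N. pss_norm \<alpha> k (\<lambda>m. truncate_seq N x m - x m)) \<longlonglongrightarrow> 0"
proof -
  define g where "g = (\<lambda>n. norm (x n) * exp (real k * \<alpha> (Suc n)))"
  have g: "summable g"
    unfolding g_def by (rule power_series_space_summable[OF x k])
  have "pss_norm \<alpha> k (\<lambda>m. truncate_seq N x m - x m) = suminf g - (\<Sum>n<N. g n)" for N
  proof -
    have "(\<lambda>n. g n - (if n \<in> {..<N} then g n else 0)) sums (suminf g - (\<Sum>n<N. g n))"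
      by (intro sums_diff summable_sums[OF g] sums_If_finite_set) simp
    moreover have "(\<lambda>n. g n - (if n \<in> {..<N} then g n else 0)) =
        (\<lambda>n. norm (truncate_seq N x n - x n) * exp (real k * \<alpha> (Suc n)))"
      by (auto simp: g_def truncate_seq_def)
    ultimately show ?thesis
      by (simp add: pss_norm_def sums_iff)
  qed
  moreover have "(\<lambda>N. suminf g - (\<Sum>n<N. g n)) \<longlonglongrightarrow> suminf g - suminf g"
    by (intro tendsto_intros summable_LIMSEQ[OF g])
  ultimately show ?thesis
    by simp
qed

text \<open>
  The sets that are eventually entered whenever they contain the limit are closed under finite
  intersections and arbitrary unions, so it is enough to test the generating sets.
\<close>
lemma limitin_topology_generated_by:
  "limitin (topology_generated_by S) f l F \<longleftrightarrow>
     l \<in> \<Union>S \<and> (\<forall>U\<in>S. l \<in> U \<longrightarrow> (\<forall>\<^sub>F x in F. f x \<in> U))" (is "?L \<longleftrightarrow> ?R")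
proof
  assume ?L
  then show ?R
    by (auto simp: limitin_def intro: topology_generated_by_Basis)
next
  assume R: ?R
  have "l \<in> U \<longrightarrow> (\<forall>\<^sub>F x in F. f x \<in> U)" if "generate_topology_on S U" for U
    using that
  proof induction
    case (UN K)
    show ?case
    proof
      assume "l \<in> \<Union>K"
      then obtain V where "V \<in> K" "\<forall>\<^sub>F x in F. f x \<in> V"
        using UN.IH by blast
      then show "\<forall>\<^sub>F x in F. f x \<in> \<Union>K"
        by (auto elim: eventually_mono)
    qed
  qed (use R in \<open>auto intro: eventually_conj\<close>)
  with R show ?L
    by (simp add: limitin_def openin_topology_generated_by_iff)
qed

abbreviation pss_topology :: "(nat \<Rightarrow> real) \<Rightarrow> (nat \<Rightarrow> 'a::{real_normed_field,banach}) topology" where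
  "pss_topology \<alpha> \<equiv> seminorm_topology (power_series_space \<alpha>) (pss_norm \<alpha>)"

lemma openin_pss_ball:
  "x \<in> power_series_space \<alpha> \<Longrightarrow> k \<ge> 1 \<Longrightarrow> r > 0 \<Longrightarrow>
   openin (pss_topology \<alpha>) {y \<in> power_series_space \<alpha>. pss_norm \<alpha> k (\<lambda>n. y n - x n) < r}"
  unfolding seminorm_topology_def by (rule topology_generated_by_Basis) blast

lemma pss_norm_diff_self: "pss_norm \<alpha> k (\<lambda>n. x n - x n) = 0"
  by (simp add: pss_norm_def)

lemma topspace_pss_topology: "topspace (pss_topology \<alpha>) = power_series_space \<alpha>"
proof (intro equalityI subsetI)
  fix x
  assume x: "x \<in> power_series_space \<alpha>"
  then have "x \<in> {y \<in> power_series_space \<alpha>. pss_norm \<alpha> 1 (\<lambda>n. y n - x n) < 1}"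
    using pss_norm_diff_self[of \<alpha> 1 x] by simp
  then show "x \<in> topspace (pss_topology \<alpha>)"
    using openin_subset[OF openin_pss_ball[OF x]] by (meson order_refl subsetD zero_less_one)
qed (auto simp: seminorm_topology_def)

text \<open>
  The generating balls are centred at arbitrary points, not at the limit \<open>l\<close>. A ball around \<open>x\<close>
  that contains \<open>l\<close> contains a smaller ball around \<open>l\<close> by the triangle inequality, so that
  distances to \<open>l\<close> suffice.
\<close>
lemma limitin_pss_topology_iff:
  "limitin (pss_topology \<alpha>) f l F \<longleftrightarrow>
     l \<in> power_series_space \<alpha> \<and> (\<forall>\<^sub>F n in F. f n \<in> power_series_space \<alpha>) \<and>
     (\<forall>k\<ge>1. ((\<lambda>n. pss_norm \<alpha> k (\<lambda>m. f n m - l m)) \<longlongrightarrow> 0) F)" (is "?L \<longleftrightarrow> ?R")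
proof
  assume L: ?L
  then have l: "l \<in> power_series_space \<alpha>"
    by (simp add: limitin_def topspace_pss_topology)
  have ev: "\<forall>\<^sub>F n in F. f n \<in> power_series_space \<alpha> \<and> pss_norm \<alpha> k (\<lambda>m. f n m - l m) < r"
    if "k \<ge> 1" "r > 0" for k r
  proof -
    have "l \<in> {y \<in> power_series_space \<alpha>. pss_norm \<alpha> k (\<lambda>n. y n - l n) < r}"
      using l \<open>r > 0\<close> pss_norm_diff_self[of \<alpha> k l] by simp
    then have "\<forall>\<^sub>F n in F. f n \<in> {y \<in> power_series_space \<alpha>. pss_norm \<alpha> k (\<lambda>n. y n - l n) < r}"
      using L openin_pss_ball[OF l that] unfolding limitin_def by blast
    then show ?thesis
      by simp
  qed
  have "((\<lambda>n. pss_norm \<alpha> k (\<lambda>m. f n m - l m)) \<longlongrightarrow> 0) F" if k: "k \<ge> 1" for k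
  proof (rule tendstoI)
    fix r :: real assume "r > 0"
    from ev[OF k this] show "\<forall>\<^sub>F n in F. dist (pss_norm \<alpha> k (\<lambda>m. f n m - l m)) 0 < r"
      by eventually_elim (use l k in \<open>simp add: pss_norm_nonneg power_series_space_diff\<close>)
  qed
  moreover have "\<forall>\<^sub>F n in F. f n \<in> power_series_space \<alpha>"
    using ev[of 1 1] by (auto elim: eventually_mono)
  ultimately show ?R
    using l by blast
next
  assume R: ?R
  then have l: "l \<in> power_series_space \<alpha>"
    by blast
  have "\<forall>\<^sub>F n in F. f n \<in> {y \<in> power_series_space \<alpha>. pss_norm \<alpha> k (\<lambda>m. y m - x m) < r}"
    if x: "x \<in> power_series_space \<alpha>" and k: "k \<ge> 1" and lr: "pss_norm \<alpha> k (\<lambda>m. l m - x m) < r" for x k r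
  proof -
    have "\<forall>\<^sub>F n in F. pss_norm \<alpha> k (\<lambda>m. f n m - l m) < r - pss_norm \<alpha> k (\<lambda>m. l m - x m)"
      using R k lr by (intro order_tendstoD(2)) auto
    moreover have "\<forall>\<^sub>F n in F. f n \<in> power_series_space \<alpha>"
      using R by blast
    ultimately show ?thesis
      by eventually_elim (use pss_norm_triangle_diff[OF _ l x k] in fastforce)
  qed
  then have "\<forall>U\<in>{{y \<in> power_series_space \<alpha>. pss_norm \<alpha> k (\<lambda>n. y n - x n) < r} | x k r.
      x \<in> power_series_space \<alpha> \<and> 1 \<le> k \<and> 0 < r}. l \<in> U \<longrightarrow> (\<forall>\<^sub>F n in F. f n \<in> U)"
    by blast
  moreover have "l \<in> topspace (pss_topology \<alpha>)"
    using l by (simp add: topspace_pss_topology)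
  ultimately show ?L
    unfolding seminorm_topology_def limitin_topology_generated_by
    by (simp only: topology_generated_by_topspace simp_thms)
qed

text \<open>
  Every single seminorm is a norm, because the weights do not vanish; hence the topology is
  Hausdorff.
\<close>
lemma limitin_pss_topology_unique:
  assumes "limitin (pss_topology \<alpha>) f l F" "limitin (pss_topology \<alpha>) f l' F" "F \<noteq> bot"
  shows "l = l'"
proof -
  note lim = assms(1,2)[unfolded limitin_pss_topology_iff]
  have E: "l \<in> power_series_space \<alpha>" "l' \<in> power_series_space \<alpha>"
    using lim by blast+
  have "((\<lambda>n. pss_norm \<alpha> 1 (\<lambda>m. f n m - l m) + pss_norm \<alpha> 1 (\<lambda>m. f n m - l' m)) \<longlongrightarrow> 0 + 0) F"
    using lim by (intro tendsto_add) auto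
  moreover have "\<forall>\<^sub>F n in F. f n \<in> power_series_space \<alpha>"
    using lim by blast
  then have "\<forall>\<^sub>F n in F. pss_norm \<alpha> 1 (\<lambda>m. l m - l' m) \<le>
      pss_norm \<alpha> 1 (\<lambda>m. f n m - l m) + pss_norm \<alpha> 1 (\<lambda>m. f n m - l' m)"
    by eventually_elim
       (use pss_norm_triangle_diff[OF E(1) _ E(2), of _ 1] in \<open>subst pss_norm_minus_commute[of _ _ _ l], simp\<close>)
  ultimately have "pss_norm \<alpha> 1 (\<lambda>m. l m - l' m) \<le> 0 + 0"
    using \<open>F \<noteq> bot\<close> by (rule tendsto_lowerbound)
  then have "pss_norm \<alpha> 1 (\<lambda>m. l m - l' m) = 0"
    using pss_norm_nonneg[OF power_series_space_diff[OF E], of 1] by simp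
  from pss_norm_eq_0_imp[OF power_series_space_diff[OF E] _ this] show ?thesis
    by (auto simp: fun_eq_iff dest: fun_cong)
qed

lemma series_from_pss_topology_eqI:
  assumes "limitin (pss_topology \<alpha>) (\<lambda>N m. \<Sum>j=a..<N. f j m) y sequentially"
  shows "series_from (power_series_space \<alpha>) (pss_norm \<alpha>) a f = y"
  unfolding series_from_def
  by (rule the_equality, rule assms)
     (rule limitin_pss_topology_unique[OF _ assms trivial_limit_sequentially])

lemma limitin_truncate_seq:
  assumes "x \<in> power_series_space \<alpha>"
  shows "limitin (pss_topology \<alpha>) (\<lambda>N. truncate_seq N x) x sequentially"
  using assms
  by (simp add: limitin_pss_topology_iff truncate_seq_in_power_series_space pss_norm_truncate_seq_tendsto)

text \<open>
  Continuity is tested through limits at each point, where the bound applies to differences and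
  turns convergence of the argument into convergence of the values.
\<close>
lemma continuous_map_pss_topologyI:
  assumes T: "\<And>x. x \<in> power_series_space \<alpha> \<Longrightarrow> T x \<in> power_series_space \<alpha>"
    and diff: "\<And>x y. x \<in> power_series_space \<alpha> \<Longrightarrow> y \<in> power_series_space \<alpha> \<Longrightarrow>
      T (\<lambda>n. x n - y n) = (\<lambda>n. T x n - T y n)"
    and bound: "\<And>p. p \<ge> 1 \<Longrightarrow> \<exists>q\<ge>1. \<exists>C. \<forall>x\<in>power_series_space \<alpha>. pss_norm \<alpha> p (T x) \<le> C * pss_norm \<alpha> q x"
  shows "continuous_map (pss_topology \<alpha>) (pss_topology \<alpha>) T"
proof -
  have "limitin (pss_topology \<alpha>) T (T x) (atin (pss_topology \<alpha>) x)"
    if x: "x \<in> power_series_space \<alpha>" for x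
  proof -
    have "limitin (pss_topology \<alpha>) (\<lambda>y. y) x (atin (pss_topology \<alpha>) x)"
      using x by (intro limitin_continuous_map[where f = "\<lambda>y. y"]) (simp_all add: topspace_pss_topology)
    then have ev: "\<forall>\<^sub>F y in atin (pss_topology \<alpha>) x. y \<in> power_series_space \<alpha>"
      and id_lim: "\<And>q. q \<ge> 1 \<Longrightarrow>
        ((\<lambda>y. pss_norm \<alpha> q (\<lambda>n. y n - x n)) \<longlongrightarrow> 0) (atin (pss_topology \<alpha>) x)"
      unfolding limitin_pss_topology_iff by blast+
    have "((\<lambda>y. pss_norm \<alpha> p (\<lambda>n. T y n - T x n)) \<longlongrightarrow> 0) (atin (pss_topology \<alpha>) x)"
      if p: "p \<ge> 1" for p
    proof -
      obtain q C where q: "q \<ge> 1"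
        and C: "\<And>x. x \<in> power_series_space \<alpha> \<Longrightarrow> pss_norm \<alpha> p (T x) \<le> C * pss_norm \<alpha> q x"
        using bound[OF p] by blast
      show ?thesis
      proof (rule tendsto_sandwich)
        show "\<forall>\<^sub>F y in atin (pss_topology \<alpha>) x. 0 \<le> pss_norm \<alpha> p (\<lambda>n. T y n - T x n)"
          using ev by eventually_elim (use x p in \<open>simp add: T power_series_space_diff pss_norm_nonneg\<close>)
        show "\<forall>\<^sub>F y in atin (pss_topology \<alpha>) x.
            pss_norm \<alpha> p (\<lambda>n. T y n - T x n) \<le> C * pss_norm \<alpha> q (\<lambda>n. y n - x n)"
          using ev by eventually_elim (use C[OF power_series_space_diff[OF _ x]] diff[OF _ x] in simp)
        show "((\<lambda>y. C * pss_norm \<alpha> q (\<lambda>n. y n - x n)) \<longlongrightarrow> 0) (atin (pss_topology \<alpha>) x)"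
          using tendsto_mult_left[OF id_lim[OF q], of C] by simp
      qed simp
    qed
    moreover have "\<forall>\<^sub>F y in atin (pss_topology \<alpha>) x. T y \<in> power_series_space \<alpha>"
      using ev by eventually_elim (rule T)
    ultimately show ?thesis
      using x by (simp add: limitin_pss_topology_iff T)
  qed
  then show ?thesis
    by (simp add: continuous_map_atin topspace_pss_topology)
qed

section \<open>The convolution algebra for stable exponents\<close>

text \<open>
  At an index where the exponent vanishes, the quotient in the definition of stability gives no
  information. Since the exponents tend to infinity there are only finitely many such indices, and
  the additive error \<open>B\<close> covers them.
\<close>
lemma stable_seq_imp_doubling:
  assumes nonneg: "\<forall>n\<ge>1. 0 \<le> \<alpha> n"
    and incr: "mono_on {1..} \<alpha>"
    and lim: "filterlim \<alpha> at_top sequentially"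
    and stable: "stable_seq \<alpha>"
  obtains L :: nat and B :: real
  where "L \<ge> 1" "\<And>n. n \<ge> 1 \<Longrightarrow> \<alpha> (2 * n) \<le> real L * \<alpha> n + B"
proof -
  obtain C where C: "\<And>n. n \<ge> 1 \<Longrightarrow> \<alpha> (2 * n) / \<alpha> n \<le> C"
    using stable by (auto simp: stable_seq_def bdd_above_def)
  have "\<forall>\<^sub>F n in sequentially. \<alpha> n > 0"
    using lim by (simp add: filterlim_at_top_dense)
  then obtain N where N: "\<And>n. n \<ge> N \<Longrightarrow> \<alpha> n > 0"
    by (auto simp: eventually_sequentially)
  define N' where "N' = max N 1"
  define L where "L = max 1 (nat \<lceil>C\<rceil>)"
  have CL: "C \<le> real L"
    unfolding L_def by linarith
  have B: "\<alpha> (2 * N') \<ge> 0"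
    using nonneg by (simp add: N'_def)
  have "\<alpha> (2 * n) \<le> real L * \<alpha> n + \<alpha> (2 * N')" if n: "n \<ge> 1" for n
  proof (cases "\<alpha> n > 0")
    case True
    then have "\<alpha> (2 * n) \<le> C * \<alpha> n"
      using C[OF n] by (simp add: field_simps)
    also have "\<dots> \<le> real L * \<alpha> n"
      using CL True by simp
    finally show ?thesis
      using B by simp
  next
    case False
    then have "n < N" "\<alpha> n = 0"
      using N[of n] nonneg[rule_format, OF n] by linarith+
    then have "\<alpha> (2 * n) \<le> \<alpha> (2 * N')"
      using n by (intro mono_onD[OF incr]) (auto simp: N'_def)
    with \<open>\<alpha> n = 0\<close> show ?thesis
      by simp
  qed
  then show thesis
    using that[of L "\<alpha> (2 * N')"] by (simp add: L_def)
qed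

locale doubling_exponents =
  fixes \<alpha> :: "nat \<Rightarrow> real" and L :: nat and B :: real
  assumes nonneg: "\<And>n. n \<ge> 1 \<Longrightarrow> 0 \<le> \<alpha> n"
    and incr: "mono_on {1..} \<alpha>"
    and L_ge_1: "L \<ge> 1"
    and doubling: "\<And>n. n \<ge> 1 \<Longrightarrow> \<alpha> (2 * n) \<le> real L * \<alpha> n + B"
begin

lemma exponent_add_le: "\<alpha> (Suc (i + j)) \<le> B + real L * \<alpha> (Suc i) + real L * \<alpha> (Suc j)"
proof -
  have "\<alpha> (Suc (i + j)) \<le> \<alpha> (2 * Suc (max i j))"
    by (rule mono_onD[OF incr]) auto
  also have "\<dots> \<le> real L * \<alpha> (Suc (max i j)) + B"
    by (rule doubling) simp
  also have "\<dots> \<le> B + real L * \<alpha> (Suc i) + real L * \<alpha> (Suc j)"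
    using nonneg[of "Suc i"] nonneg[of "Suc j"] by (auto simp: max_def)
  finally show ?thesis .
qed

text \<open>
  Multiplicative form of the preceding estimate. The factor \<open>L\<close> moves from the exponent sequence
  to the index of the seminorm.
\<close>
lemma weight_add_le:
  "exp (real p * \<alpha> (Suc (i + j))) \<le>
     exp (real p * B) * (exp (real (L * p) * \<alpha> (Suc i)) * exp (real (L * p) * \<alpha> (Suc j)))"
  using mult_left_mono[OF exponent_add_le, of "real p" i j]
  by (simp add: exp_add[symmetric] algebra_simps)

text \<open>
  By the weight estimate, the weighted terms of \<open>x * y\<close> are dominated by the Cauchy product of the
  weighted terms of \<open>x\<close> and \<open>y\<close>, a convergent series with sum the product of the two norms.
\<close>
lemma
  assumes x: "x \<in> power_series_space \<alpha>" and y: "y \<in> power_series_space \<alpha>"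
  shows seq_conv_in_power_series_space: "seq_conv x y \<in> power_series_space \<alpha>"
    and pss_norm_seq_conv_le: "p \<ge> 1 \<Longrightarrow> pss_norm \<alpha> p (seq_conv x y) \<le>
      exp (real p * B) * pss_norm \<alpha> (L * p) x * pss_norm \<alpha> (L * p) y"
proof -
  define a where "a = (\<lambda>p i. norm (x i) * exp (real (L * p) * \<alpha> (Suc i)))"
  define b where "b = (\<lambda>p i. norm (y i) * exp (real (L * p) * \<alpha> (Suc i)))"
  have le: "norm (seq_conv x y m) * exp (real p * \<alpha> (Suc m)) \<le>
      exp (real p * B) * (\<Sum>i\<le>m. a p i * b p (m - i))" for m p
  proof -
    have "norm (seq_conv x y m) * exp (real p * \<alpha> (Suc m)) \<le>
        (\<Sum>i\<le>m. norm (x i) * norm (y (m - i))) * exp (real p * \<alpha> (Suc m))"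
      unfolding seq_conv_def atLeast0AtMost norm_mult[symmetric]
      by (intro mult_right_mono norm_sum) simp
    also have "\<dots> = (\<Sum>i\<le>m. norm (x i) * norm (y (m - i)) * exp (real p * \<alpha> (Suc (i + (m - i)))))"
      by (simp add: sum_distrib_right)
    also have "\<dots> \<le> (\<Sum>i\<le>m. norm (x i) * norm (y (m - i)) *
        (exp (real p * B) * (exp (real (L * p) * \<alpha> (Suc i)) * exp (real (L * p) * \<alpha> (Suc (m - i))))))"
      by (intro sum_mono mult_left_mono weight_add_le) simp
    also have "\<dots> = exp (real p * B) * (\<Sum>i\<le>m. a p i * b p (m - i))"
      by (simp add: sum_distrib_left a_def b_def mult_ac)
    finally show ?thesis .
  qed
  have product: "(\<lambda>m. exp (real p * B) * (\<Sum>i\<le>m. a p i * b p (m - i))) sums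
      (exp (real p * B) * (pss_norm \<alpha> (L * p) x * pss_norm \<alpha> (L * p) y))" if p: "p \<ge> 1" for p
  proof -
    have "L * p \<ge> 1"
      using L_ge_1 p by simp
    then have "summable (\<lambda>i. norm (a p i))" "summable (\<lambda>i. norm (b p i))"
      using power_series_space_summable[OF x, of "L * p"] power_series_space_summable[OF y, of "L * p"]
      by (simp_all add: a_def b_def)
    from sums_mult[OF Cauchy_product_sums[OF this]] show ?thesis
      unfolding pss_norm_def a_def b_def .
  qed
  have summable: "summable (\<lambda>m. norm (seq_conv x y m) * exp (real p * \<alpha> (Suc m)))" if "p \<ge> 1" for p
    using le by (intro summable_comparison_test'[OF sums_summable[OF product[OF that]]]) simp
  then show "seq_conv x y \<in> power_series_space \<alpha>"
    by (simp add: power_series_space_def)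
  show "pss_norm \<alpha> p (seq_conv x y) \<le>
      exp (real p * B) * pss_norm \<alpha> (L * p) x * pss_norm \<alpha> (L * p) y" if p: "p \<ge> 1"
    using suminf_le[OF le summable[OF p] sums_summable[OF product[OF p]]] sums_unique[OF product[OF p]]
    by (simp add: pss_norm_def mult.assoc)
qed

lemma conv_power_in_power_series_space:
  "\<theta> \<in> power_series_space \<alpha> \<Longrightarrow> conv_power \<theta> k \<in> power_series_space \<alpha>"
  by (induction k) (auto intro: basis_seq_in_power_series_space seq_conv_in_power_series_space)

section \<open>The convolution operator\<close>

lemma continuous_map_seq_conv:
  assumes "\<theta> \<in> power_series_space \<alpha>"
  shows "continuous_map (pss_topology \<alpha>) (pss_topology \<alpha>) (seq_conv \<theta>)"
proof (rule continuous_map_pss_topologyI)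
  fix p :: nat
  assume p: "p \<ge> 1"
  then show "\<exists>q\<ge>1. \<exists>C. \<forall>x\<in>power_series_space \<alpha>. pss_norm \<alpha> p (seq_conv \<theta> x) \<le> C * pss_norm \<alpha> q x"
    using pss_norm_seq_conv_le[OF assms _ p] L_ge_1 by (intro exI[of _ "L * p"]) auto
qed (use assms in \<open>auto intro: seq_conv_in_power_series_space seq_conv_diff_right\<close>)

text \<open>
  The partial sums of the defining series are the truncations of the shifted symbol, which belongs
  to the space and is therefore the limit of its truncations.
\<close>
lemma conv_op_basis_eq_seq_conv:
  assumes "\<theta> \<in> power_series_space \<alpha>"
  shows "conv_op_basis \<alpha> \<theta> n = seq_conv \<theta> (basis_seq n)"
proof -
  have "(\<lambda>N m. \<Sum>j=n..<N. \<theta> (j - n) * basis_seq j m) = (\<lambda>N. truncate_seq N (seq_conv \<theta> (basis_seq n)))"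
  proof (intro ext)
    fix N m
    have "(\<Sum>j=n..<N. \<theta> (j - n) * basis_seq j m) = (\<Sum>j=n..<N. if m = j then \<theta> (j - n) else 0)"
      by (intro sum.cong) (auto simp: basis_seq_def)
    also have "\<dots> = truncate_seq N (seq_conv \<theta> (basis_seq n)) m"
      by (simp add: truncate_seq_def seq_conv_basis_seq)
    finally show "(\<Sum>j=n..<N. \<theta> (j - n) * basis_seq j m) = truncate_seq N (seq_conv \<theta> (basis_seq n)) m" .
  qed
  then show ?thesis
    unfolding conv_op_basis_def
    by (intro series_from_pss_topology_eqI)
       (simp add: assms limitin_truncate_seq seq_conv_in_power_series_space basis_seq_in_power_series_space)
qed

text \<open>
  The partial sums of the defining series are the convolutions of \<open>\<theta>\<close> with the truncations of \<open>x\<close>,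
  so they converge to \<open>\<theta> * x\<close> by continuity of convolution.
\<close>
lemma conv_op_eq_seq_conv:
  assumes \<theta>: "\<theta> \<in> power_series_space \<alpha>" and x: "x \<in> power_series_space \<alpha>"
  shows "conv_op \<alpha> \<theta> x = seq_conv \<theta> x"
  unfolding conv_op_def
proof (rule series_from_pss_topology_eqI)
  have "limitin (pss_topology \<alpha>) (seq_conv \<theta> \<circ> (\<lambda>N. truncate_seq N x)) (seq_conv \<theta> x) sequentially"
    by (rule continuous_map_limit[OF continuous_map_seq_conv[OF \<theta>] limitin_truncate_seq[OF x]])
  then show "limitin (pss_topology \<alpha>) (\<lambda>N m. \<Sum>n=0..<N. x n * conv_op_basis \<alpha> \<theta> n m)
      (seq_conv \<theta> x) sequentially"
    by (simp add: conv_op_basis_eq_seq_conv[OF \<theta>] sum_seq_conv_basis_seq atLeast0LessThan o_def)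
qed

lemma continuous_linear_operator_conv_op:
  assumes \<theta>: "\<theta> \<in> power_series_space \<alpha>"
  shows "continuous_linear_operator (power_series_space \<alpha>) (pss_norm \<alpha>) (conv_op \<alpha> \<theta>)"
proof -
  have "continuous_map (pss_topology \<alpha>) (pss_topology \<alpha>) (conv_op \<alpha> \<theta>)"
    by (rule continuous_map_eq[OF continuous_map_seq_conv[OF \<theta>]])
       (simp add: topspace_pss_topology conv_op_eq_seq_conv \<theta>)
  then show ?thesis
    using \<theta> by (simp add: continuous_linear_operator_def conv_op_eq_seq_conv
        seq_conv_in_power_series_space power_series_space_add power_series_space_scale
        seq_conv_add_right seq_conv_scale_right)
qed

lemma conv_op_funpow_eq_seq_conv:
  assumes \<theta>: "\<theta> \<in> power_series_space \<alpha>" and x: "x \<in> power_series_space \<alpha>"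
  shows "(conv_op \<alpha> \<theta> ^^ k) x = seq_conv (conv_power \<theta> k) x"
  by (induction k)
     (simp_all add: assms conv_op_eq_seq_conv seq_conv_in_power_series_space
       conv_power_in_power_series_space seq_conv_assoc)

lemma pss_norm_conv_op_funpow_le:
  assumes \<theta>: "\<theta> \<in> power_series_space \<alpha>" and x: "x \<in> power_series_space \<alpha>" and p: "p \<ge> 1"
  shows "pss_norm \<alpha> p ((conv_op \<alpha> \<theta> ^^ k) x) \<le>
    exp (real p * B) * pss_norm \<alpha> (L * p) (conv_power \<theta> k) * pss_norm \<alpha> (L * p) x"
  using pss_norm_seq_conv_le[OF conv_power_in_power_series_space[OF \<theta>] x p]
  by (simp add: conv_op_funpow_eq_seq_conv[OF \<theta> x])

lemma topologizable_conv_op: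
  assumes \<theta>: "\<theta> \<in> power_series_space \<alpha>"
  shows "topologizable (power_series_space \<alpha>) (pss_norm \<alpha>) (conv_op \<alpha> \<theta>)"
  unfolding topologizable_def
proof (intro conjI allI impI continuous_linear_operator_conv_op[OF \<theta>])
  fix p :: nat
  assume p: "p \<ge> 1"
  have Lp: "L * p \<ge> 1"
    using L_ge_1 p by simp
  have "\<exists>M>0. \<forall>x\<in>power_series_space \<alpha>. pss_norm \<alpha> p ((conv_op \<alpha> \<theta> ^^ k) x) \<le> M * pss_norm \<alpha> (L * p) x"
    for k
  proof (intro exI conjI ballI)
    \<comment> \<open>The summand \<open>1\<close> keeps the constant positive when the convolution power vanishes.\<close>
    let ?M = "exp (real p * B) * pss_norm \<alpha> (L * p) (conv_power \<theta> k) + 1"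
    have "0 \<le> exp (real p * B) * pss_norm \<alpha> (L * p) (conv_power \<theta> k)"
      by (intro mult_nonneg_nonneg pss_norm_nonneg conv_power_in_power_series_space \<theta> Lp) simp
    then show "0 < ?M"
      by simp
    fix x :: "nat \<Rightarrow> 'a"
    assume x: "x \<in> power_series_space \<alpha>"
    show "pss_norm \<alpha> p ((conv_op \<alpha> \<theta> ^^ k) x) \<le> ?M * pss_norm \<alpha> (L * p) x"
      using pss_norm_conv_op_funpow_le[OF \<theta> x p, of k] pss_norm_nonneg[OF x Lp]
      by (simp add: distrib_right)
  qed
  with Lp show "\<exists>q\<ge>1. \<forall>k\<ge>1. \<exists>M>0. \<forall>x\<in>power_series_space \<alpha>.
      pss_norm \<alpha> p ((conv_op \<alpha> \<theta> ^^ k) x) \<le> M * pss_norm \<alpha> q x"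
    by blast
qed

lemma m_topologizable_conv_opI:
  assumes \<theta>: "\<theta> \<in> power_series_space \<alpha>"
    and powers: "\<And>p. p \<ge> 1 \<Longrightarrow> \<exists>D>0. \<forall>k\<ge>1. pss_norm \<alpha> p (conv_power \<theta> k) \<le> D ^ k"
  shows "m_topologizable (power_series_space \<alpha>) (pss_norm \<alpha>) (conv_op \<alpha> \<theta>)"
  unfolding m_topologizable_def
proof (intro conjI allI impI continuous_linear_operator_conv_op[OF \<theta>])
  fix p :: nat
  assume p: "p \<ge> 1"
  have Lp: "L * p \<ge> 1"
    using L_ge_1 p by simp
  then obtain D where D: "D > 0" "\<And>k. k \<ge> 1 \<Longrightarrow> pss_norm \<alpha> (L * p) (conv_power \<theta> k) \<le> D ^ k"
    using powers by blast
  \<comment> \<open>The constant factor \<open>A\<close>, being at least \<open>1\<close>, is absorbed into the \<open>k\<close>-th power because \<open>k \<ge> 1\<close>.\<close>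
  define A where "A = max 1 (exp (real p * B))"
  define C where "C = A * max 1 D"
  have A: "1 \<le> A" "exp (real p * B) \<le> A"
    by (simp_all add: A_def)
  have "C \<ge> 1"
    unfolding C_def using A(1) using mult_mono[of 1 A 1 "max 1 D"] by simp
  moreover have "pss_norm \<alpha> p ((conv_op \<alpha> \<theta> ^^ k) x) \<le> C ^ k * pss_norm \<alpha> (L * p) x"
    if k: "k \<ge> 1" and x: "x \<in> power_series_space \<alpha>" for k x
  proof -
    have "exp (real p * B) * pss_norm \<alpha> (L * p) (conv_power \<theta> k) \<le> A * max 1 D ^ k"
      using D A k by (intro mult_mono order_trans[OF D(2)] power_mono pss_norm_nonneg
          conv_power_in_power_series_space \<theta> Lp) auto
    also have "\<dots> \<le> A ^ k * max 1 D ^ k"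
      using A(1) k by (intro mult_right_mono self_le_power) auto
    also have "\<dots> = C ^ k"
      by (simp add: C_def power_mult_distrib)
    finally show ?thesis
      using pss_norm_conv_op_funpow_le[OF \<theta> x p, of k] pss_norm_nonneg[OF x Lp]
      by (meson mult_right_mono order_trans)
  qed
  ultimately show "\<exists>q\<ge>1. \<exists>C\<ge>1. \<forall>k\<ge>1. \<forall>x\<in>power_series_space \<alpha>.
      pss_norm \<alpha> p ((conv_op \<alpha> \<theta> ^^ k) x) \<le> C ^ k * pss_norm \<alpha> q x"
    using Lp by blast
qed

text \<open>
  Evaluation at \<open>basis_seq 0\<close>, the unit of convolution, recovers \<open>\<theta>\<^sup>*\<^sup>k\<close> from the \<open>k\<close>-th iterate.
\<close>
lemma m_topologizable_conv_opD:
  fixes \<theta> :: "nat \<Rightarrow> 'a::{real_normed_field,banach}"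
  assumes \<theta>: "\<theta> \<in> power_series_space \<alpha>"
    and "m_topologizable (power_series_space \<alpha>) (pss_norm \<alpha>) (conv_op \<alpha> \<theta>)" and "p \<ge> 1"
  shows "\<exists>D>0. \<forall>k\<ge>1. pss_norm \<alpha> p (conv_power \<theta> k) \<le> D ^ k"
proof -
  obtain q C where "C \<ge> 1" and C: "\<And>k x. k \<ge> 1 \<Longrightarrow> x \<in> power_series_space \<alpha> \<Longrightarrow>
      pss_norm \<alpha> p ((conv_op \<alpha> \<theta> ^^ k) x) \<le> C ^ k * pss_norm \<alpha> q x"
    using assms(2,3) unfolding m_topologizable_def by blast
  \<comment> \<open>The norm of the first basis vector, which is at least \<open>1\<close>.\<close>
  define A where "A = exp (real q * \<alpha> (Suc 0))"
  have A: "A \<ge> 1"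
    using nonneg[of "Suc 0"] by (simp add: A_def)
  have "pss_norm \<alpha> p (conv_power \<theta> k) \<le> (C * A) ^ k" if k: "k \<ge> 1" for k
  proof -
    have "pss_norm \<alpha> p (conv_power \<theta> k) \<le> C ^ k * A"
      using C[OF k basis_seq_in_power_series_space[of 0]]
      by (simp add: conv_op_funpow_eq_seq_conv[OF \<theta> basis_seq_in_power_series_space]
          pss_norm_basis_seq A_def)
    also have "\<dots> \<le> C ^ k * A ^ k"
      using \<open>C \<ge> 1\<close> A k by (intro mult_left_mono self_le_power) auto
    finally show ?thesis
      by (simp add: power_mult_distrib)
  qed
  moreover have "C * A > 0"
    using \<open>C \<ge> 1\<close> A by simp
  ultimately show ?thesis
    by blast
qed

end

theorem theorem4p4:
  fixes \<alpha> :: "nat \<Rightarrow> real"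
  assumes nonneg: "\<forall>n\<ge>1. 0 \<le> \<alpha> n"
    and incr: "mono_on {1..} \<alpha>"
    and lim: "filterlim \<alpha> at_top sequentially"
    and stable: "stable_seq \<alpha>"
  shows "(\<forall>\<theta>::nat \<Rightarrow> 'a::{real_normed_field,banach}. \<theta> \<in> power_series_space \<alpha> \<longrightarrow>
            topologizable (power_series_space \<alpha>) (pss_norm \<alpha>) (conv_op \<alpha> \<theta>)) \<and>
         (\<forall>\<theta>::nat \<Rightarrow> 'a. \<theta> \<in> power_series_space \<alpha> \<longrightarrow>
            (m_topologizable (power_series_space \<alpha>) (pss_norm \<alpha>) (conv_op \<alpha> \<theta>) \<longleftrightarrow>
             (\<forall>p\<ge>1. \<exists>D>0. \<forall>k\<ge>1. pss_norm \<alpha> p (conv_power \<theta> k) \<le> D ^ k)))"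
proof -
  obtain L B where L: "L \<ge> 1" "\<And>n. n \<ge> 1 \<Longrightarrow> \<alpha> (2 * n) \<le> real L * \<alpha> n + B"
    using stable_seq_imp_doubling[OF assms] by blast
  interpret doubling_exponents \<alpha> L B
    by unfold_locales (use nonneg incr L in auto)
  show ?thesis
    using topologizable_conv_op m_topologizable_conv_opI m_topologizable_conv_opD by blast
qed

end
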